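(* There exist $5$-GDDs of each of the types $2^{35}$, $2^{71}$, $10^{23}$, $2^{40} 6^1$, $4^{40} 12^1$, $10^{10} 18^1$ and $20^{10} 36^1$.
   Context: A group divisible design, $k$-GDD, of type $g_1^{u_1} g_2^{u_2} \cdots g_n^{u_n}$ is a triple $(V,\mathcal{G},\mathcal{B})$ such that: $V$ is a set of cardinality $u_1 g_1 + \dots + u_n g_n$; $\mathcal{G}$ is a partition of $V$ into $u_i$ subsets of cardinality $g_i$, $i=1,\dots,n$, called groups; $\mathcal{B}$ is a non-empty collection of $k$-subsets of $V$, called blocks; and each pair of elements from distinct groups occurs in precisely one block but no pair of distinct elements from the same group occurs in any block. *)

theory Defs
  imports "HOL-Library.Multiset" "HOL-Library.Disjoint_Sets"
begin

text \<open>A list [(g1, u1), \<dots>, (gn, un)] stands for the type g1^u1 \<dots> gn^un.\<close>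

type_synonym gdd_type = "(nat \<times> nat) list"

definition group_sizes :: "gdd_type \<Rightarrow> nat multiset" where
  "group_sizes T = (\<Sum>(g, u)\<leftarrow>T. replicate_mset u g)"

text \<open>A set of blocks loses nothing against a multiset here: for k at least 2, a repeated block
  would cover some pair twice.\<close>

definition is_GDD :: "nat \<Rightarrow> gdd_type \<Rightarrow> 'a set \<Rightarrow> 'a set set \<Rightarrow> 'a set set \<Rightarrow> bool" where
  "is_GDD k T V \<G> \<B> \<longleftrightarrow>
     finite V \<and> card V = (\<Sum>(g, u)\<leftarrow>T. u * g) \<and>
     partition_on V \<G> \<and> image_mset card (mset_set \<G>) = group_sizes T \<and>
     \<B> \<noteq> {} \<and> (\<forall>b\<in>\<B>. b \<subseteq> V \<and> card b = k) \<and>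
     (\<forall>X\<in>\<G>. \<forall>Y\<in>\<G>. X \<noteq> Y \<longrightarrow>
        (\<forall>x\<in>X. \<forall>y\<in>Y. \<exists>!b. b \<in> \<B> \<and> x \<in> b \<and> y \<in> b)) \<and>
     (\<forall>X\<in>\<G>. \<forall>x\<in>X. \<forall>y\<in>X. x \<noteq> y \<longrightarrow>
        \<not> (\<exists>b\<in>\<B>. x \<in> b \<and> y \<in> b))"

text \<open>Since V is finite, taking the points to be natural numbers is no restriction.\<close>

definition GDD_exists :: "nat \<Rightarrow> gdd_type \<Rightarrow> bool" where
  "GDD_exists k T \<longleftrightarrow> (\<exists>(V :: nat set) \<G> \<B>. is_GDD k T V \<G> \<B>)"

end

theory Submission
  imports Defs "HOL-Library.Code_Binary_Nat"
begin

text \<open>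
  Each design is given by base blocks and two automorphisms \<open>s\<close>, \<open>t\<close> with \<open>t \<circ> s = s\<^sup>e \<circ> t\<close>, so that the
  blocks \<open>s\<^sup>i (t\<^sup>j b)\<close> form a family invariant under both. The design property at a point is
  inherited by its images under \<open>s\<close> and \<open>t\<close>. It therefore suffices to inspect, for one point \<open>r\<close> of
  every orbit, the blocks through \<open>r\<close>: with \<open>r\<close> removed, they must partition the points outside the
  group of \<open>r\<close>. The base blocks were found by a computer search over prescribed automorphism groups.
\<close>

section \<open>The pair condition at a single point and its transport by automorphisms\<close>

definition balanced_at :: "'a set \<Rightarrow> 'a set set \<Rightarrow> 'a set set \<Rightarrow> 'a \<Rightarrow> bool" where
  "balanced_at V \<G> \<B> x \<longleftrightarrow>
     (\<forall>y\<in>V. (\<forall>X\<in>\<G>. x \<in> X \<longrightarrow> y \<notin> X) \<longrightarrow> (\<exists>!b. b \<in> \<B> \<and> x \<in> b \<and> y \<in> b)) \<and>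
     (\<forall>b\<in>\<B>. \<forall>X\<in>\<G>. x \<in> b \<longrightarrow> x \<in> X \<longrightarrow> b \<inter> X = {x})"

lemma balanced_atD:
  assumes "balanced_at V \<G> \<B> x"
  shows "y \<in> V \<Longrightarrow> (\<forall>X\<in>\<G>. x \<in> X \<longrightarrow> y \<notin> X) \<Longrightarrow> \<exists>!b. b \<in> \<B> \<and> x \<in> b \<and> y \<in> b"
    and "b \<in> \<B> \<Longrightarrow> X \<in> \<G> \<Longrightarrow> x \<in> b \<Longrightarrow> x \<in> X \<Longrightarrow> b \<inter> X = {x}"
  using assms by (simp_all add: balanced_at_def)

text \<open>\<open>f\<close> acts injectively on the finite family \<open>\<A>\<close>, hence onto
  it: closure under \<open>f\<close> already yields closure under preimages.\<close>

lemma image_surj_on_family: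
  assumes "bij_betw f V V" "finite V" "\<A> \<subseteq> Pow V" "\<And>A. A \<in> \<A> \<Longrightarrow> f ` A \<in> \<A>" "B \<in> \<A>"
  obtains A where "A \<in> \<A>" "B = f ` A"
proof -
  have "inj_on f V" using assms(1) by (rule bij_betw_imp_inj_on)
  then have "inj_on ((`) f) \<A>"
    using inj_on_subset[OF inj_on_image_Pow assms(3)] by blast
  moreover have "finite \<A>" using assms(2,3) finite_subset by auto
  moreover have "(`) f ` \<A> \<subseteq> \<A>" using assms(4) by blast
  ultimately have "(`) f ` \<A> = \<A>" by (rule endo_inj_surj[rotated -1])
  then show thesis using assms(5) that by blast
qed

text \<open>\<open>f\<close> permutes the points, the groups and the blocks, so a second point
  \<open>y\<close> and any block or group through \<open>f x\<close> can be pulled back to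
  \<open>x\<close>, compared there and pushed forward again.\<close>

lemma balanced_at_image:
  assumes f: "bij_betw f V V" and fin: "finite V"
    and \<G>: "\<G> \<subseteq> Pow V" "\<And>X. X \<in> \<G> \<Longrightarrow> f ` X \<in> \<G>"
    and \<B>: "\<B> \<subseteq> Pow V" "\<And>b. b \<in> \<B> \<Longrightarrow> f ` b \<in> \<B>"
    and x: "x \<in> V" "balanced_at V \<G> \<B> x"
  shows "balanced_at V \<G> \<B> (f x)"
proof -
  have inj: "inj_on f V" using f by (rule bij_betw_imp_inj_on)
  have mem: "f z \<in> f ` A \<longleftrightarrow> z \<in> A" if "z \<in> V" "A \<in> \<G> \<or> A \<in> \<B>" for z A
    using that \<G>(1) \<B>(1) inj inj_on_image_mem_iff[OF inj, of z A] by blast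
  have surjG: "\<exists>X\<in>\<G>. Y = f ` X" if "Y \<in> \<G>" for Y
    by (rule image_surj_on_family[OF f fin \<G> that], assumption) blast
  have surjB: "\<exists>X\<in>\<B>. Y = f ` X" if "Y \<in> \<B>" for Y
    by (rule image_surj_on_family[OF f fin \<B> that], assumption) blast
  have 1: "\<exists>!b. b \<in> \<B> \<and> f x \<in> b \<and> y \<in> b"
    if y: "y \<in> V" and sep: "\<forall>X\<in>\<G>. f x \<in> X \<longrightarrow> y \<notin> X" for y
  proof -
    obtain z where z: "z \<in> V" "y = f z" using f y by (auto simp: bij_betw_def)
    have "\<forall>X\<in>\<G>. x \<in> X \<longrightarrow> z \<notin> X" using sep z \<G>(2) by blast
    then have "\<exists>!b. b \<in> \<B> \<and> x \<in> b \<and> z \<in> b" by (rule balanced_atD(1)[OF x(2) z(1)])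
    then obtain b where b: "b \<in> \<B> \<and> x \<in> b \<and> z \<in> b"
      and u: "\<forall>c. c \<in> \<B> \<and> x \<in> c \<and> z \<in> c \<longrightarrow> c = b" by (rule ex1E)
    show ?thesis
    proof
      show "f ` b \<in> \<B> \<and> f x \<in> f ` b \<and> y \<in> f ` b" using b z \<B>(2) by blast
      show "c = f ` b" if c: "c \<in> \<B> \<and> f x \<in> c \<and> y \<in> c" for c
      proof -
        obtain d where d: "d \<in> \<B>" "c = f ` d" using surjB c by blast
        then have "x \<in> d" "z \<in> d" using c mem[of x d] mem[of z d] x(1) z by simp_all
        then have "d = b" using d(1) u by simp
        then show ?thesis using d(2) by simp
      qed
    qed
  qed
  have 2: "b \<inter> X = {f x}" if "b \<in> \<B>" "X \<in> \<G>" "f x \<in> b" "f x \<in> X" for b X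
  proof -
    obtain c where c: "c \<in> \<B>" "b = f ` c" using surjB \<open>b \<in> \<B>\<close> by blast
    obtain Y where Y: "Y \<in> \<G>" "X = f ` Y" using surjG \<open>X \<in> \<G>\<close> by blast
    have "x \<in> c" "x \<in> Y" using that c Y mem[of x c] mem[of x Y] x(1) by simp_all
    then have "c \<inter> Y = {x}" using balanced_atD(2)[OF x(2)] c Y by blast
    moreover have "f ` (c \<inter> Y) = b \<inter> X"
      using c Y \<G>(1) \<B>(1) inj_on_image_Int[OF inj, of c Y] by auto
    ultimately show ?thesis by auto
  qed
  show ?thesis unfolding balanced_at_def
    by (intro conjI ballI impI) (rule 1 2; assumption)+
qed

lemma is_GDD_if_balanced:
  assumes "finite V" "card V = (\<Sum>(g, u)\<leftarrow>T. u * g)" "partition_on V \<G>"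
    and "image_mset card (mset_set \<G>) = group_sizes T"
    and "\<B> \<noteq> {}" "\<And>b. b \<in> \<B> \<Longrightarrow> b \<subseteq> V \<and> card b = k"
    and bal: "\<And>x. x \<in> V \<Longrightarrow> balanced_at V \<G> \<B> x"
  shows "is_GDD k T V \<G> \<B>"
proof -
  have sub: "X \<subseteq> V" if "X \<in> \<G>" for X using assms(3) that by (auto simp: partition_on_def)
  have 1: "\<exists>!b. b \<in> \<B> \<and> x \<in> b \<and> y \<in> b"
    if "X \<in> \<G>" "Y \<in> \<G>" "X \<noteq> Y" "x \<in> X" "y \<in> Y" for X Y x y
  proof (rule balanced_atD(1)[OF bal])
    show "x \<in> V" "y \<in> V" using that sub by auto
    \<comment> \<open>\<open>balanced_at\<close> asks that \<open>y\<close> avoid every group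
      through \<open>x\<close>; disjointness leaves only \<open>X\<close>.\<close>
    have "Z = X" if "Z \<in> \<G>" "x \<in> Z" for Z
      using disjointD[OF partition_onD2[OF assms(3)] that(1) \<open>X \<in> \<G>\<close>] that(2) \<open>x \<in> X\<close> by auto
    moreover have "y \<notin> X"
      using disjointD[OF partition_onD2[OF assms(3)] \<open>X \<in> \<G>\<close> \<open>Y \<in> \<G>\<close> \<open>X \<noteq> Y\<close>] \<open>y \<in> Y\<close> by auto
    ultimately show "\<forall>Z\<in>\<G>. x \<in> Z \<longrightarrow> y \<notin> Z" by auto
  qed
  have 2: "\<not> (\<exists>b\<in>\<B>. x \<in> b \<and> y \<in> b)"
    if "X \<in> \<G>" "x \<in> X" "y \<in> X" "x \<noteq> y" for X x y
  proof
    assume "\<exists>b\<in>\<B>. x \<in> b \<and> y \<in> b"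
    then obtain b where b: "b \<in> \<B>" "x \<in> b" "y \<in> b" by auto
    have "x \<in> V" using that sub by auto
    then have "b \<inter> X = {x}" using balanced_atD(2)[OF bal b(1) that(1) b(2) that(2)] by simp
    then show False using b(3) that by auto
  qed
  show ?thesis unfolding is_GDD_def
    using assms(6) by (intro conjI assms(1-5) ballI impI) (simp_all add: 1 2)
qed

section \<open>Orbits of blocks under an automorphism\<close>

primrec iterates :: "('a \<Rightarrow> 'a) \<Rightarrow> nat \<Rightarrow> 'a \<Rightarrow> 'a list" where
  "iterates f 0 x = []"
| "iterates f (Suc m) x = x # iterates f m (f x)"

lemma set_iterates: "set (iterates f m x) = {(f ^^ i) x | i. i < m}"
proof (induction m arbitrary: x)
  case (Suc m)
  have "{(f ^^ i) x | i. i < Suc m} = insert x {(f ^^ Suc i) x | i. i < m}"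
    by (force simp: less_Suc_eq_0_disj simp del: funpow.simps)
  then show ?case by (simp add: Suc funpow_swap1 funpow_Suc_right del: funpow.simps)
qed simp

text \<open>Blocks are lists and repetitions are kept: a block that returns before \<open>m\<close>
  steps is simply listed several times.\<close>

definition develop :: "('a \<Rightarrow> 'a) \<Rightarrow> nat \<Rightarrow> 'a list list \<Rightarrow> 'a list list" where
  "develop f m bs = concat (map (iterates (map f) m) bs)"

lemma in_develop:
  "c \<in> set (develop f m bs) \<longleftrightarrow> (\<exists>b\<in>set bs. \<exists>i<m. c = (map f ^^ i) b)"
  by (auto simp: develop_def set_iterates)

text \<open>Only the last iterate needs an argument: its image is the \<open>m\<close>-th power,
  which wraps around to the base block.\<close>

lemma develop_closed:
  assumes "c \<in> set (develop f m bs)" and "\<forall>b\<in>set bs. (map f ^^ m) b = b"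
  shows "map f c \<in> set (develop f m bs)"
proof -
  obtain b i where b: "b \<in> set bs" and i: "i < m" and c: "c = (map f ^^ i) b"
    using assms(1) by (auto simp: in_develop)
  show ?thesis
  proof (cases "Suc i < m")
    case True
    then show ?thesis using b c by (auto simp: in_develop intro!: bexI[of _ b] exI[of _ "Suc i"])
  next
    case False
    then have "m = Suc i" using i by simp
    then have "map f c = (map f ^^ 0) b" using assms(2) b c by auto
    moreover have "0 < m" using i by simp
    ultimately show ?thesis using b unfolding in_develop by blast
  qed
qed

text \<open>Moving \<open>t\<close> past one \<open>s\<close> turns it into \<open>s ^^ e\<close>,
  so moving it past \<open>i\<close> of them gives exponent \<open>e * i\<close>. The relation is
  known only below \<open>n\<close>, and invariance of that range under \<open>s\<close> keeps the
  intermediate points there.\<close>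

lemma develop_commuting:
  assumes comm: "\<forall>x<n. t (s x) = (s ^^ e) (t x)" and s: "s ` {..<n} \<subseteq> {..<n}"
    and c: "set c \<subseteq> {..<n}"
  shows "map t ((map s ^^ i) c) = (map s ^^ (e * i)) (map t c)"
proof (induction i)
  case (Suc i)
  have map_funpow: "(map s ^^ j) d = map (s ^^ j) d" for j d
    by (induction j) auto
  have "(s ^^ i) x < n" if "x < n" for x
    using that s by (induction i) auto
  then have "map t ((map s ^^ Suc i) c) = (map s ^^ e) (map t ((map s ^^ i) c))"
    using comm c by (auto simp: map_funpow)
  then show ?case using Suc by (simp add: funpow_add)
qed simp

section \<open>Testing balance at a point by one comparison of lists\<close>

primrec blocks_through :: "nat \<Rightarrow> (nat \<Rightarrow> nat) \<Rightarrow> nat \<Rightarrow> nat list \<Rightarrow> nat list list" where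
  "blocks_through r f 0 b = []"
| "blocks_through r f (Suc m) b =
     (if r \<in> set b then [b] else []) @ blocks_through r f m (map f b)"

lemma set_blocks_through:
  "set (concat (map (blocks_through r f m) bs)) = {b \<in> set (develop f m bs). r \<in> set b}"
proof -
  have "set (blocks_through r f m b) = {c \<in> set (iterates (map f) m b). r \<in> set c}" for b
    by (induction m arbitrary: b) auto
  then show ?thesis by (auto simp: develop_def)
qed

text \<open>Sorting each block before \<open>remdups\<close> merges copies of one block that arise
  in different orders, as when \<open>t\<close> carries a base block to a shift of itself. The
  comparison of sorted lists is an equality of multisets, so it tests at once that every point is
  covered and that none is covered twice.\<close>

definition check_local :: "nat list list \<Rightarrow> (nat \<Rightarrow> nat) \<Rightarrow> nat \<Rightarrow> nat list list \<Rightarrow> nat \<Rightarrow> bool" where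
  "check_local gs f m bs r \<longleftrightarrow>
     sort (concat (map (remove1 r) (remdups (map sort (concat (map (blocks_through r f m) bs)))))) =
     sort (concat (filter (\<lambda>g. r \<notin> set g) gs))"

text \<open>\<open>N\<close> lists the points outside the group of \<open>r\<close> without
  repetition, hence so does \<open>M\<close>. Every such point therefore lies on exactly one block
  through \<open>r\<close>, and no block through \<open>r\<close> meets its group again.\<close>

lemma balanced_at_if_check_local:
  assumes gs: "distinct (concat gs)" and dist: "\<forall>b\<in>set (develop f m bs). distinct b"
    and r: "r \<in> set (concat gs)" and check: "check_local gs f m bs r"
  shows "balanced_at (set (concat gs)) (set ` set gs) (set ` set (develop f m bs)) r"
proof -
  let ?B = "develop f m bs"
  define L where "L = remdups (map sort (concat (map (blocks_through r f m) bs)))"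
  define M where "M = concat (map (remove1 r) L)"
  define N where "N = concat (filter (\<lambda>g. r \<notin> set g) gs)"
  have eq: "sort M = sort N"
    using check by (simp add: check_local_def L_def M_def N_def)
  have "distinct N"
    using gs unfolding N_def by (induction gs) auto
  then have dM: "distinct M" using eq distinct_sort by metis
  have sM: "set M = set N" using eq set_sort by metis
  have L: "set c \<in> set ` set ?B" "r \<in> set c" "distinct c" "sorted c" if "c \<in> set L" for c
    using that dist unfolding L_def set_remdups set_map set_blocks_through by auto
  have exL: "\<exists>c\<in>set L. b = set c" if "b \<in> set ` set ?B" "r \<in> b" for b
    using that unfolding L_def set_remdups set_map set_blocks_through by force
  have notin: "y \<notin> X" if yM: "y \<in> set M" and X: "X \<in> set ` set gs" and rX: "r \<in> X" for y X
  proof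
    assume y: "y \<in> X"
    obtain g where g: "g \<in> set gs" "X = set g" using X by auto
    obtain h where h: "h \<in> set gs" "r \<notin> set h" "y \<in> set h" using yM sM by (auto simp: N_def)
    have "set g \<inter> set h = {}"
      using gs g h rX unfolding distinct_concat_iff by metis
    then show False using g h y by auto
  qed
  show ?thesis unfolding balanced_at_def
  proof (intro conjI ballI impI)
    fix y assume y: "y \<in> set (concat gs)" and sep: "\<forall>X\<in>set ` set gs. r \<in> X \<longrightarrow> y \<notin> X"
    then have "y \<in> set N" by (auto simp: N_def)
    then have "y \<in> set M" using sM by simp
    then obtain c where c: "c \<in> set L" "y \<in> set (remove1 r c)" by (auto simp: M_def)
    show "\<exists>!b. b \<in> set ` set ?B \<and> r \<in> b \<and> y \<in> b"
    proof
      show "set c \<in> set ` set ?B \<and> r \<in> set c \<and> y \<in> set c"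
        using L[OF c(1)] c(2) set_remove1_subset by fastforce
    next
      fix b assume b: "b \<in> set ` set ?B \<and> r \<in> b \<and> y \<in> b"
      then obtain d where d: "d \<in> set L" "b = set d" using exL by auto
      have "y \<noteq> r" using c L(3)[OF c(1)] by auto
      then have "y \<in> set (remove1 r d)" using b d by simp
      \<comment> \<open>\<open>M\<close> is a concatenation without repetitions, so two of its
        pieces that share \<open>y\<close> coincide.\<close>
      then have "remove1 r c = remove1 r d"
        using dM c d unfolding M_def distinct_concat_iff by (auto simp: disjoint_iff)
      then have "set c - {r} = set d - {r}" using L(3)[OF c(1)] L(3)[OF d(1)] by (metis set_remove1_eq)
      then show "b = set c" using L(2)[OF c(1)] L(2)[OF d(1)] d(2) by auto
    qed
  next
    fix b X assume b: "b \<in> set ` set ?B" and X: "X \<in> set ` set gs" and r: "r \<in> b" "r \<in> X"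
    obtain c where c: "c \<in> set L" "b = set c" using exL b r by auto
    have "y = r" if "y \<in> b" "y \<in> X" for y
    proof (rule ccontr)
      assume "y \<noteq> r"
      \<comment> \<open>A second common point of \<open>b\<close> and \<open>X\<close> would be
        listed in \<open>M\<close>, which avoids the group of \<open>r\<close>.\<close>
      then have "y \<in> set M" using that c by (auto simp: M_def)
      then show False using notin X r that by auto
    qed
    then show "b \<inter> X = {r}" using r by blast
  qed
qed

section \<open>Automorphisms and the complete check of a design\<close>

definition image_in :: "nat list list \<Rightarrow> (nat \<Rightarrow> nat) \<Rightarrow> nat list \<Rightarrow> bool" where
  "image_in gs f g \<longleftrightarrow> sort (map f g) \<in> set gs"

text \<open>Groups are compared as lists after sorting the image, which is why the designs below
  list every group in increasing order.\<close>

definition check_perm :: "nat \<Rightarrow> nat list list \<Rightarrow> (nat \<Rightarrow> nat) \<Rightarrow> bool" where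
  "check_perm n gs f \<longleftrightarrow> sort (map f [0..<n]) = [0..<n] \<and> list_all (image_in gs f) gs"

lemma check_permD:
  assumes "check_perm n gs f"
  shows "bij_betw f {..<n} {..<n}" and "X \<in> set ` set gs \<Longrightarrow> f ` X \<in> set ` set gs"
proof -
  have sort: "sort (map f [0..<n]) = [0..<n]" using assms by (simp add: check_perm_def)
  have "distinct (map f [0..<n])" using arg_cong[OF sort, of distinct] by simp
  moreover have "f ` {0..<n} = {0..<n}" using arg_cong[OF sort, of set] by simp
  ultimately show "bij_betw f {..<n} {..<n}" by (simp add: bij_betw_def distinct_map lessThan_atLeast0)
  show "f ` X \<in> set ` set gs" if X: "X \<in> set ` set gs"
  proof -
    obtain g where g: "g \<in> set gs" "X = set g" using X by auto
    then have "sort (map f g) \<in> set gs" using assms by (auto simp: check_perm_def image_in_def list_all_iff)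
    then have "set (sort (map f g)) \<in> set ` set gs" by (rule imageI)
    then show ?thesis using g by simp
  qed
qed

text \<open>
  \<open>iterate\<close> and the predicates after it exist for the sake of \<open>code_simp\<close>, which rewrites under
  binders: a composition of functions, or an abstraction mapped over a list, would be unfolded
  symbolically.
\<close>

primrec iterate :: "nat \<Rightarrow> ('a \<Rightarrow> 'a) \<Rightarrow> 'a \<Rightarrow> 'a" where
  "iterate 0 f x = x"
| "iterate (Suc m) f x = iterate m f (f x)"

lemma iterate_eq_funpow: "iterate m f x = (f ^^ m) x"
  by (induction m arbitrary: x) (simp_all add: funpow_swap1)

definition commute_at :: "(nat \<Rightarrow> nat) \<Rightarrow> (nat \<Rightarrow> nat) \<Rightarrow> nat \<Rightarrow> nat \<Rightarrow> bool" where
  "commute_at s t e x \<longleftrightarrow> t (s x) = iterate e s (t x)"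

definition returns_after :: "nat \<Rightarrow> (nat \<Rightarrow> nat) \<Rightarrow> nat list \<Rightarrow> bool" where
  "returns_after m f b \<longleftrightarrow> iterate m (map f) b = b"

definition valid_block :: "nat \<Rightarrow> nat \<Rightarrow> nat list \<Rightarrow> bool" where
  "valid_block k n b \<longleftrightarrow> length b = k \<and> distinct b \<and> list_all ((>) n) b"

text \<open>
  \<open>gs\<close> lists the groups, \<open>ps\<close> a point of every orbit of \<open>s\<close> together with the length of that orbit,
  and \<open>rs\<close> points whose images under the powers of \<open>t\<close> include all points in \<open>ps\<close>.
\<close>

definition check_design ::
  "nat \<Rightarrow> gdd_type \<Rightarrow> nat list list \<Rightarrow> (nat \<Rightarrow> nat) \<Rightarrow> nat \<Rightarrow> (nat \<Rightarrow> nat) \<Rightarrow> nat \<Rightarrow> nat \<Rightarrow>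
    nat list list \<Rightarrow> (nat \<times> nat) list \<Rightarrow> nat list \<Rightarrow> bool" where
  "check_design k T gs s m t l e bs ps rs \<longleftrightarrow>
     (let n = (\<Sum>(g, u)\<leftarrow>T. u * g) in
     sort (concat gs) = [0..<n] \<and> [] \<notin> set gs \<and>
     sort (map length gs) = sort (concat (map (\<lambda>(g, u). replicate u g) T)) \<and>
     check_perm n gs s \<and> check_perm n gs t \<and>
     list_all (commute_at s t e) [0..<n] \<and>
     bs \<noteq> [] \<and> list_all (valid_block k n) bs \<and> 0 < m \<and> 0 < l \<and>
     list_all (returns_after l t) bs \<and> list_all (returns_after m s) (develop t l bs) \<and>
     sort (concat (map (\<lambda>(p, j). iterates s j p) ps)) = [0..<n] \<and>
     list_all (List.member (concat (develop t l [rs]))) (map fst ps) \<and>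
     list_all ((>) n) rs \<and> list_all (check_local gs s m (develop t l bs)) rs)"

text \<open>The blocks are the base blocks developed first by \<open>t\<close> and then by
  \<open>s\<close>. This family is closed under \<open>s\<close> by cyclicity and under
  \<open>t\<close> by the commutation relation, so balance spreads from \<open>rs\<close> by
  \<open>t\<close> to \<open>ps\<close> and from there by \<open>s\<close> to all points.\<close>

lemma GDD_exists_if_check_design:
  assumes "check_design k T gs s m t l e bs ps rs"
  shows "GDD_exists k T"
proof -
  define n where "n = (\<Sum>(g, u)\<leftarrow>T. u * g)"
  define B where "B = develop s m (develop t l bs)"
  define V where "V = {..<n}"
  define \<G> where "\<G> = set ` set gs"
  define \<B> where "\<B> = set ` set B"
  note chk = assms[unfolded check_design_def Let_def, folded n_def]
  have sgs: "sort (concat gs) = [0..<n]" and ne: "[] \<notin> set gs"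
    and len: "sort (map length gs) = sort (concat (map (\<lambda>(g, u). replicate u g) T))"
    and perm: "check_perm n gs s" "check_perm n gs t" and ml: "0 < m" "0 < l"
    and comm: "\<forall>x\<in>set [0..<n]. t (s x) = (s ^^ e) (t x)" and bs: "bs \<noteq> []"
    and cyct: "\<forall>b\<in>set bs. (map t ^^ l) b = b"
    and cycs: "\<forall>b\<in>set (develop t l bs). (map s ^^ m) b = b"
    and base: "\<forall>b\<in>set bs. length b = k \<and> distinct b \<and> (\<forall>x\<in>set b. x < n)"
    and ps: "sort (concat (map (\<lambda>(p, j). iterates s j p) ps)) = [0..<n]"
    and rs: "\<forall>p\<in>set (map fst ps). p \<in> set (concat (develop t l [rs]))"
    and rsn: "\<forall>r\<in>set rs. r < n" and loc: "\<forall>r\<in>set rs. check_local gs s m (develop t l bs) r"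
    using chk unfolding list_all_iff commute_at_def returns_after_def iterate_eq_funpow valid_block_def
      List.member_iff
    by - (elim conjE, assumption)+
  note s = check_permD[OF perm(1), folded V_def \<G>_def] and t = check_permD[OF perm(2), folded V_def \<G>_def]
  have sV: "s ` V \<subseteq> V" and tV: "t ` V \<subseteq> V" and inj: "inj_on s V" "inj_on t V"
    using s(1) t(1) by (auto simp: bij_betw_def)
  have dgs: "distinct (concat gs)" using arg_cong[OF sgs, of distinct] by simp
  have setgs: "set (concat gs) = V" using arg_cong[OF sgs, of set] by (simp add: V_def lessThan_atLeast0)
  have funpow_pres: "length ((map f ^^ i) b) = k \<and> distinct ((map f ^^ i) b) \<and> set ((map f ^^ i) b) \<subseteq> V"
    if "inj_on f V" "f ` V \<subseteq> V" "length b = k \<and> distinct b \<and> set b \<subseteq> V" for f i b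
    using that by (induction i) (auto simp: distinct_map inj_on_subset)
  have tdev: "length b = k \<and> distinct b \<and> set b \<subseteq> V" if b: "b \<in> set (develop t l bs)" for b
  proof -
    obtain d i where "d \<in> set bs" "b = (map t ^^ i) d" using b unfolding in_develop by blast
    then show ?thesis using base funpow_pres[OF inj(2) tV, of d i] by (auto simp: V_def)
  qed
  have Bprop: "length b = k \<and> distinct b \<and> set b \<subseteq> V" if "b \<in> set B" for b
    using that tdev funpow_pres[OF inj(1) sV] unfolding B_def in_develop[of _ s] by blast
  have closed_s: "map s c \<in> set B" if "c \<in> set B" for c
    using that develop_closed cycs unfolding B_def by blast
  have closed_t: "map t c \<in> set B" if c: "c \<in> set B" for c
  proof -
    obtain d i where d: "d \<in> set (develop t l bs)" and ci: "c = (map s ^^ i) d"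
      using c unfolding B_def in_develop[of _ s] by blast
    have "map t d \<in> set (develop t l bs)" using d cyct by (rule develop_closed)
    \<comment> \<open>\<open>map t d\<close> itself is listed because \<open>0 < m\<close>. Closure
      under \<open>s\<close> then supplies every power, which matters since \<open>e * i\<close> may
      exceed \<open>m\<close>.\<close>
    then have "(map s ^^ 0) (map t d) \<in> set B" using ml unfolding B_def in_develop[of _ s] by blast
    then have "(map s ^^ j) (map t d) \<in> set B" for j
      by (induction j) (auto intro: closed_s)
    moreover have "map t c = (map s ^^ (e * i)) (map t d)"
      unfolding ci using comm sV tdev[OF d] by (intro develop_commuting) (auto simp: V_def)
    ultimately show ?thesis by simp
  qed
  have \<G>V: "\<G> \<subseteq> Pow V" using setgs by (auto simp: \<G>_def)
  have \<B>V: "\<B> \<subseteq> Pow V" using Bprop by (auto simp: \<B>_def)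
  have closed_\<B>: "s ` b \<in> \<B>" "t ` b \<in> \<B>" if b: "b \<in> \<B>" for b
  proof -
    obtain c where c: "c \<in> set B" "b = set c" using b by (auto simp: \<B>_def)
    have "set (map s c) \<in> \<B>" "set (map t c) \<in> \<B>"
      using closed_s[OF c(1)] closed_t[OF c(1)] unfolding \<B>_def by blast+
    then show "s ` b \<in> \<B>" "t ` b \<in> \<B>" using c(2) by simp_all
  qed
  have fin: "finite V" by (simp add: V_def)
  have bal_s: "balanced_at V \<G> \<B> (s x)" if "x \<in> V" "balanced_at V \<G> \<B> x" for x
    by (rule balanced_at_image[OF s(1) fin \<G>V s(2) \<B>V closed_\<B>(1) that])
  have bal_t: "balanced_at V \<G> \<B> (t x)" if "x \<in> V" "balanced_at V \<G> \<B> x" for x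
    by (rule balanced_at_image[OF t(1) fin \<G>V t(2) \<B>V closed_\<B>(2) that])
  \<comment> \<open>Stated for lists of points, so that \<open>rs\<close> can be developed like a
    single block: \<open>develop t l [rs]\<close> holds the images of all its points.\<close>
  let ?good = "\<lambda>p. \<forall>x\<in>set p. x \<in> V \<and> balanced_at V \<G> \<B> x"
  have good_dev: "?good p"
    if p: "p \<in> set (develop f j ps)" and ps: "\<forall>q\<in>set ps. ?good q" and f: "f ` V \<subseteq> V"
      and bal: "\<And>x. x \<in> V \<Longrightarrow> balanced_at V \<G> \<B> x \<Longrightarrow> balanced_at V \<G> \<B> (f x)" for p f j ps
  proof -
    have "?good ((map f ^^ i) q)" if "?good q" for i q
      using that f by (induction i) (auto simp: bal)
    then show ?thesis using p ps unfolding in_develop by blast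
  qed
  have cover: "set (concat (map (\<lambda>(p, j). iterates s j p) ps)) = V"
    using arg_cong[OF ps, of set] by (simp add: V_def lessThan_atLeast0)
  have "balanced_at V \<G> \<B> r" if "r \<in> set rs" for r
    using balanced_at_if_check_local[OF dgs, where f = s and m = m and bs = "develop t l bs" and r = r,
        folded B_def, unfolded setgs, folded \<G>_def \<B>_def] Bprop loc rsn that
    by (simp add: V_def)
  then have "\<forall>q\<in>set [rs]. ?good q" using rsn by (simp add: V_def)
  then have "\<forall>p\<in>set (develop t l [rs]). ?good p"
    using good_dev[OF _ _ tV bal_t] by blast
  then have "\<forall>x\<in>set (concat (develop t l [rs])). x \<in> V \<and> balanced_at V \<G> \<B> x" by auto
  then have good_ps: "p \<in> V \<and> balanced_at V \<G> \<B> p" if "p \<in> set (map fst ps)" for p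
    using that rs by blast
  have orbit: "(s ^^ i) p \<in> V \<and> balanced_at V \<G> \<B> ((s ^^ i) p)"
    if "p \<in> set (map fst ps)" for i p
    using good_ps[OF that] sV by (induction i) (auto simp: bal_s)
  have bal: "balanced_at V \<G> \<B> x" if x: "x \<in> V" for x
  proof -
    obtain p j where "(p, j) \<in> set ps" "x \<in> set (iterates s j p)"
      using x unfolding cover[symmetric] by auto
    then obtain i where "p \<in> set (map fst ps)" "x = (s ^^ i) p"
      unfolding set_iterates by force
    then show ?thesis using orbit by simp
  qed
  have "is_GDD k T V \<G> \<B>"
  proof (rule is_GDD_if_balanced[OF fin _ _ _ _ _ bal])
    show "card V = (\<Sum>(g, u)\<leftarrow>T. u * g)" by (simp add: V_def n_def)
    \<comment> \<open>A repeated nonempty list would repeat its points in the concatenation, and the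
      empty list is excluded by \<open>ne\<close>.\<close>
    have dist: "distinct gs" using dgs ne by (simp add: distinct_concat_iff)
    have disj: "set g \<inter> set h = {}" if "g \<in> set gs" "h \<in> set gs" "g \<noteq> h" for g h
      using dgs that unfolding distinct_concat_iff by blast
    show "partition_on V \<G>"
    proof (rule partition_onI)
      show "\<Union>\<G> = V" using setgs by (simp add: \<G>_def)
      show "{} \<notin> \<G>" using ne by (auto simp: \<G>_def)
      show "disjnt p q" if "p \<in> \<G>" "q \<in> \<G>" "p \<noteq> q" for p q
        using that disj by (auto simp: \<G>_def disjnt_def)
    qed
    have inj_set: "inj_on set (set gs)"
    proof (rule inj_onI, rule ccontr)
      fix g h assume g: "g \<in> set gs" "h \<in> set gs" "set g = set h" "g \<noteq> h"
      then have "set g = {}" using disj[OF g(1,2,4)] by simp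
      then show False using g(1) ne by simp
    qed
    \<comment> \<open>Passing between \<open>\<G>\<close> and \<open>gs\<close> preserves
      multiplicities: \<open>gs\<close> is distinct, and \<open>set\<close> is injective on it
      because distinct groups are disjoint and nonempty.\<close>
    have "image_mset card (mset_set \<G>) = image_mset card (image_mset set (mset gs))"
      unfolding \<G>_def image_mset_mset_set[OF inj_set, symmetric] using mset_set_set[OF dist] by simp
    also have "\<dots> = image_mset length (mset gs)"
      using dgs by (auto simp: image_mset.compositionality distinct_concat_iff distinct_card
          intro!: image_mset_cong)
    also have "\<dots> = mset (concat (map (\<lambda>(g, u). replicate u g) T))"
      using arg_cong[OF len, of mset] by simp
    also have "\<dots> = group_sizes T"
      unfolding group_sizes_def by (induction T) (auto simp: split_def)
    finally show "image_mset card (mset_set \<G>) = group_sizes T" .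
    have "develop t l bs \<noteq> []"
      using bs ml by (cases bs; cases l) (simp_all add: develop_def)
    then have "B \<noteq> []"
      using ml unfolding B_def by (cases "develop t l bs"; cases m) (simp_all add: develop_def[of s])
    then show "\<B> \<noteq> {}" by (simp add: \<B>_def)
    show "b \<subseteq> V \<and> card b = k" if "b \<in> \<B>" for b
      using that Bprop by (auto simp: \<B>_def distinct_card)
  qed
  then show ?thesis unfolding GDD_exists_def by blast
qed

section \<open>The seven designs\<close>

definition shift_2_35 :: "nat \<Rightarrow> nat" where
  "shift_2_35 x =
     (if x < 60 then x + 10 else x - 60)"

text \<open>A point is \<open>10 * i + a\<close> with \<open>i\<close> in Z_7 and
  \<open>a < 10\<close>. The shift adds 1 to \<open>i\<close>; this map doubles \<open>i\<close> and
  rotates the classes \<open>a = 0, 2, 4\<close> and \<open>a = 1, 3, 5\<close>, fixing the other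
  four.\<close>

definition mult_2_35 :: "nat \<Rightarrow> nat" where
  "mult_2_35 x =
     (10 * (2 * (x div 10) mod 7) + (if x mod 10 < 6 then (x mod 10 + 2) mod 6 else x mod 10))"

text \<open>Doubling gives \<open>e = 2\<close> and, as 8 is 1 modulo 7, order 3. The last base
  block is carried by \<open>mult_2_35\<close> to its own second shift, so its orbit is
  short.\<close>

lemma GDD_2_35: "GDD_exists 5 [(2, 35)]"
proof (rule GDD_exists_if_check_design)
  show "check_design 5 [(2, 35)]
    (map (\<lambda>j. [2 * j, 2 * j + 1]) [0..<35])
    shift_2_35 7 mult_2_35 3 2
    [[0, 2, 38, 46, 60], [0, 3, 22, 27, 40], [0, 5, 8, 25, 68], [0, 6, 23, 37, 69],
     [0, 9, 15, 50, 67], [0, 11, 21, 43, 54], [0, 16, 18, 44, 62], [0, 19, 41, 45, 66],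
     [0, 24, 32, 47, 49], [0, 28, 39, 53, 59], [0, 31, 36, 51, 65], [1, 7, 45, 57, 68],
     [1, 36, 39, 43, 55], [6, 16, 27, 28, 56]]
    (map (\<lambda>p. (p, 7)) [0..<10])
    [0, 1, 6, 7, 8, 9]"
    by code_simp
qed

text \<open>Points below 140 are \<open>20 * i + a\<close> with \<open>i\<close> in Z_7; 140 and 141
  are fixed and form a group. The multiplier again doubles \<open>i\<close>, now rotating six
  triples of classes \<open>a < 18\<close> and fixing \<open>a = 18, 19\<close>.\<close>

definition shift_2_71 :: "nat \<Rightarrow> nat" where
  "shift_2_71 x =
     (if x < 120 then x + 20 else if x < 140 then x - 120 else x)"

definition mult_2_71 :: "nat \<Rightarrow> nat" where
  "mult_2_71 x =
     (if x < 140 then 20 * (2 * (x div 20) mod 7) +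
        (if x mod 20 < 18 then 6 * (x mod 20 div 6) + (x mod 20 + 2) mod 6 else x mod 20) else x)"

lemma GDD_2_71: "GDD_exists 5 [(2, 71)]"
proof (rule GDD_exists_if_check_design)
  show "check_design 5 [(2, 71)]
    (map (\<lambda>j. [2 * j, 2 * j + 1]) [0..<71])
    shift_2_71 7 mult_2_71 3 2
    [[0, 2, 7, 67, 101], [0, 3, 93, 97, 131], [0, 5, 51, 57, 87], [0, 6, 8, 14, 92],
     [0, 9, 20, 102, 128], [0, 10, 85, 112, 116], [0, 12, 32, 47, 138], [0, 13, 35, 75, 132],
     [0, 15, 23, 70, 127], [0, 16, 30, 49, 135], [0, 17, 40, 61, 73], [0, 18, 81, 110, 133],
     [0, 19, 54, 62, 136], [0, 22, 64, 139, 141], [0, 25, 42, 76, 96], [0, 26, 60, 113, 134],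
     [0, 28, 41, 71, 98], [0, 29, 68, 107, 123], [0, 31, 50, 55, 65], [0, 36, 46, 109, 119],
     [0, 37, 43, 52, 105], [0, 38, 84, 122, 140], [0, 39, 115, 130, 137], [0, 45, 48, 90, 99],
     [0, 56, 78, 95, 121], [0, 58, 77, 88, 126], [0, 66, 69, 103, 118], [0, 79, 83, 89, 91],
     [1, 3, 14, 26, 83], [1, 6, 45, 125, 135], [1, 8, 72, 89, 129], [1, 11, 59, 70, 88],
     [1, 15, 19, 94, 119], [1, 23, 65, 138, 141], [1, 32, 109, 114, 118], [1, 33, 38, 51, 96],
     [1, 35, 66, 95, 108], [1, 36, 61, 134, 137], [1, 39, 85, 123, 140], [1, 49, 56, 91, 111],
     [1, 110, 113, 136, 139], [6, 11, 32, 46, 128], [6, 16, 57, 66, 131], [6, 18, 33, 34, 126],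
     [6, 49, 76, 95, 140], [6, 91, 94, 133, 141], [7, 15, 77, 91, 135], [7, 17, 34, 96, 136],
     [7, 36, 49, 93, 139], [7, 39, 55, 78, 138]]
    (map (\<lambda>p. (p, 7)) [0..<20] @ map (\<lambda>p. (p, 1)) [140, 141])
    [0, 1, 6, 7, 12, 13, 18, 19, 140, 141]"
    by code_simp
qed

text \<open>Points are \<open>4 * i + c\<close> with \<open>i\<close> in Z_55 and
  \<open>220 + 2 * j + d\<close> with \<open>j\<close> in Z_5; the shift adds 1 to \<open>i\<close>
  and to \<open>j\<close>.\<close>

definition shift_10_23 :: "nat \<Rightarrow> nat" where
  "shift_10_23 x =
     (if x < 216 then x + 4 else if x < 220 then x - 216 else if x < 228 then x + 2 else x - 8)"

text \<open>On Z_55 this is \<open>i\<close> to \<open>16 * i\<close>, or \<open>16 * i + 11\<close>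
  when \<open>c\<close> is 2 or 3; on Z_5 it is \<open>j\<close> to \<open>j + 2\<close>. The order
  is 5 since 16 has order 5 modulo 55, and \<open>e = 16\<close> also fits Z_5 because 16 is 1
  modulo 5.\<close>

definition mult_10_23 :: "nat \<Rightarrow> nat" where
  "mult_10_23 x =
     (if x < 220 then 4 * ((16 * (x div 4) + (if x mod 4 < 2 then 0 else 11)) mod 55) + x mod 4
      else if x < 226 then x + 4 else x - 6)"

text \<open>Apart from \<open>[220..<230]\<close>, a group joins one coset of the multiples of 11 in
  Z_55 over the classes \<open>c = 0, 1\<close> or \<open>c = 2, 3\<close>; the offset 11 in the
  multiplier respects these cosets.\<close>

lemma GDD_10_23: "GDD_exists 5 [(10, 23)]"
proof (rule GDD_exists_if_check_design)
  show "check_design 5 [(10, 23)]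
    ([220..<230] # concat (map (\<lambda>c. [concat (map (\<lambda>a. [44 * a + c, 44 * a + c + 1]) [0..<5]),
      concat (map (\<lambda>a. [44 * a + c + 2, 44 * a + c + 3]) [0..<5])]) (map ((*) 4) [0..<11])))
    shift_10_23 55 mult_10_23 5 16
    [[0, 2, 55, 114, 199], [0, 3, 10, 84, 144], [0, 5, 12, 83, 149], [0, 6, 27, 41, 228],
     [0, 9, 202, 207, 229], [0, 21, 102, 168, 194], [0, 25, 39, 63, 117], [1, 2, 102, 126, 181],
     [1, 3, 75, 146, 215], [1, 17, 49, 73, 185]]
    (map (\<lambda>p. (p, 55)) [0, 1, 2, 3] @ map (\<lambda>p. (p, 5)) [220, 221])
    [0, 1, 2, 3, 220, 221]"
    by code_simp
qed

text \<open>Two copies of Z_40, interleaved by parity, and six further points that the shift swaps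
  in pairs.\<close>

definition shift_2_40_6_1 :: "nat \<Rightarrow> nat" where
  "shift_2_40_6_1 x =
     (if x < 78 then x + 2 else if x < 80 then x - 78 else if x < 83 then x + 3 else x - 3)"

lemma GDD_2_40_6_1: "GDD_exists 5 [(2, 40), (6, 1)]"
proof (rule GDD_exists_if_check_design)
  show "check_design 5 [(2, 40), (6, 1)]
    ([80..<86] # map (\<lambda>j. [j, j + 40]) [0..<40])
    shift_2_40_6_1 40 id 1 1
    [[0, 1, 44, 58, 74], [0, 2, 27, 28, 73], [0, 3, 65, 70, 84], [0, 4, 12, 33, 60],
     [0, 5, 17, 34, 43], [0, 11, 15, 39, 47], [0, 18, 67, 77, 80], [0, 19, 38, 69, 85],
     [0, 35, 41, 55, 57]]
    (map (\<lambda>p. (p, 40)) [0, 1] @ map (\<lambda>p. (p, 2)) [80, 81, 82])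
    [0, 1, 80, 81, 82]"
    by code_simp
qed

text \<open>Z_160, with the cosets of its subgroup of order 4 as groups, and twelve further points
  in three cycles of length 4.\<close>

definition shift_4_40_12_1 :: "nat \<Rightarrow> nat" where
  "shift_4_40_12_1 x =
     (if x < 159 then x + 1 else if x = 159 then 0 else if x < 169 then x + 3 else x - 9)"

lemma GDD_4_40_12_1: "GDD_exists 5 [(4, 40), (12, 1)]"
proof (rule GDD_exists_if_check_design)
  show "check_design 5 [(4, 40), (12, 1)]
    ([160..<172] # map (\<lambda>j. [j, j + 40, j + 80, j + 120]) [0..<40])
    shift_4_40_12_1 160 id 1 1
    [[0, 1, 21, 64, 149], [0, 2, 46, 56, 93], [0, 3, 77, 134, 171], [0, 4, 52, 66, 136],
     [0, 5, 22, 147, 166], [0, 6, 51, 124, 133], [0, 7, 79, 129, 144], [0, 8, 61, 100, 119],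
     [0, 25, 55, 126, 167]]
    ([(0, 160)] @ map (\<lambda>p. (p, 4)) [160, 161, 162])
    [0, 160, 161, 162]"
    by code_simp
qed

text \<open>Points below 108 are \<open>36 * i + 12 * j + c\<close> with \<open>i\<close>,
  \<open>j\<close> in Z_3 and \<open>c < 12\<close>. Shift and multiplier add 1 to \<open>i\<close>
  and to \<open>j\<close>, so they commute and \<open>e = 1\<close>; the ten remaining points are
  fixed. The classes \<open>c = 10, 11\<close> together make up the group of size 18.\<close>

definition shift_10_10_18_1 :: "nat \<Rightarrow> nat" where
  "shift_10_10_18_1 x =
     (if x < 72 then x + 36 else if x < 108 then x - 72 else x)"

definition mult_10_10_18_1 :: "nat \<Rightarrow> nat" where
  "mult_10_10_18_1 x =
     (if x < 108 then if x mod 36 < 24 then x + 12 else x - 24 else x)"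

lemma GDD_10_10_18_1: "GDD_exists 5 [(10, 10), (18, 1)]"
proof (rule GDD_exists_if_check_design)
  show "check_design 5 [(10, 10), (18, 1)]
    ([108..<118] # concat (map (\<lambda>j. [j + 10, j + 11]) (map ((*) 12) [0..<9])) # map (\<lambda>j. [12 * j..<12 * j + 10]) [0..<9])
    shift_10_10_18_1 3 mult_10_10_18_1 3 1
    [[0, 10, 29, 104, 115], [0, 11, 63, 105, 111], [0, 12, 79, 82, 96], [0, 13, 25, 59, 91],
     [0, 14, 35, 50, 62], [0, 15, 36, 76, 83], [0, 16, 44, 78, 97], [0, 17, 65, 74, 94],
     [0, 18, 51, 77, 116], [0, 20, 34, 38, 75], [0, 21, 30, 56, 92], [0, 23, 67, 80, 88],
     [0, 26, 39, 52, 108], [0, 27, 46, 81, 114], [0, 28, 41, 55, 112], [0, 31, 68, 90, 98],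
     [0, 32, 89, 95, 113], [0, 33, 54, 58, 69], [0, 37, 57, 64, 102], [0, 42, 70, 85, 100],
     [0, 43, 61, 99, 109], [0, 45, 49, 71, 101], [0, 53, 73, 86, 110], [0, 66, 93, 107, 117],
     [1, 10, 49, 77, 85], [1, 11, 45, 98, 115], [1, 15, 31, 81, 82], [1, 17, 54, 67, 111],
     [1, 20, 62, 90, 107], [1, 22, 44, 56, 88], [1, 26, 76, 91, 117], [1, 27, 34, 50, 74],
     [1, 30, 86, 99, 113], [1, 32, 43, 58, 108], [1, 35, 42, 78, 101], [1, 38, 46, 69, 112],
     [1, 40, 80, 93, 105], [1, 41, 57, 63, 100], [1, 51, 75, 87, 95], [1, 52, 83, 104, 116],
     [1, 55, 59, 68, 114], [2, 11, 19, 57, 81], [2, 16, 42, 89, 114], [2, 17, 28, 69, 82],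
     [2, 18, 58, 78, 102], [2, 20, 44, 55, 105], [2, 21, 31, 65, 75], [2, 27, 41, 67, 107],
     [2, 29, 68, 91, 99], [2, 32, 35, 52, 109], [2, 34, 45, 79, 116], [2, 40, 46, 56, 111],
     [2, 71, 76, 90, 100], [3, 18, 55, 94, 99], [3, 20, 29, 82, 117], [3, 21, 68, 81, 89],
     [3, 22, 28, 64, 76], [3, 30, 44, 46, 110], [3, 32, 59, 77, 92], [3, 35, 90, 104, 112],
     [3, 52, 69, 71, 102], [3, 54, 79, 88, 115], [4, 17, 43, 70, 103], [4, 22, 79, 93, 113],
     [4, 35, 55, 81, 110], [4, 41, 59, 65, 101], [5, 10, 30, 69, 109], [5, 34, 43, 78, 104],
     [5, 59, 66, 81, 108], [6, 11, 31, 91, 103]]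
    (map (\<lambda>p. (p, 3)) [0..<36] @ map (\<lambda>p. (p, 1)) [108..<118])
    ([0..<12] @ [108..<118])"
    by code_simp
qed

text \<open>Points are \<open>6 * i + c\<close> with \<open>i\<close> in Z_30,
  \<open>180 + 2 * j + d\<close> with \<open>j\<close> in Z_10, and \<open>200 + 12 * h + a\<close>
  with \<open>h\<close> in Z_3. The shift adds 1 to \<open>i\<close>, \<open>j\<close> and
  \<open>h\<close>; the commuting multiplier of order 3 rotates \<open>c\<close> by 2 modulo 6 and
  \<open>a\<close> by 4 modulo 12.\<close>

definition shift_20_10_36_1 :: "nat \<Rightarrow> nat" where
  "shift_20_10_36_1 x =
     (if x < 174 then x + 6 else if x < 180 then x - 174 else if x < 198 then x + 2
      else if x < 200 then x - 18 else if x < 224 then x + 12 else x - 24)"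

definition mult_20_10_36_1 :: "nat \<Rightarrow> nat" where
  "mult_20_10_36_1 x =
     (if x < 180 then if x mod 6 < 4 then x + 2 else x - 4
      else if x < 200 then x else if (x - 200) mod 12 < 8 then x + 4 else x - 8)"

text \<open>Each of the nine groups below 180 fixes \<open>i\<close> modulo 3 and a pair of
  consecutive classes \<open>c\<close>; shift and multiplier together permute these groups
  transitively.\<close>

lemma GDD_20_10_36_1: "GDD_exists 5 [(20, 10), (36, 1)]"
proof (rule GDD_exists_if_check_design)
  show "check_design 5 [(20, 10), (36, 1)]
    ([180..<200] # [200..<236] #
      map (\<lambda>j. concat (map (\<lambda>i. [18 * i + 2 * j, 18 * i + 2 * j + 1]) [0..<10])) [0..<9])
    shift_20_10_36_1 30 mult_20_10_36_1 3 1
    [[0, 2, 53, 148, 173], [0, 3, 113, 142, 234], [0, 5, 80, 111, 204], [0, 6, 28, 186, 225],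
     [0, 7, 14, 193, 229], [0, 8, 82, 157, 226], [0, 9, 23, 124, 139], [0, 10, 63, 102, 232],
     [0, 11, 103, 122, 165], [0, 12, 132, 147, 149], [0, 13, 95, 161, 209], [0, 16, 45, 65, 205],
     [0, 20, 114, 194, 215], [0, 24, 58, 154, 195], [0, 26, 83, 138, 230], [0, 27, 92, 175, 190],
     [0, 29, 41, 181, 228], [0, 30, 131, 159, 182], [0, 33, 76, 116, 216], [0, 39, 87, 191, 210],
     [0, 50, 117, 199, 227], [0, 52, 153, 169, 219], [0, 61, 77, 119, 207], [0, 75, 121, 177, 233],
     [0, 93, 99, 133, 231], [1, 9, 95, 159, 197], [1, 11, 85, 196, 234], [1, 25, 69, 186, 204]]
    (map (\<lambda>p. (p, 30)) [0, 1, 2, 3, 4, 5] @ map (\<lambda>p. (p, 10)) [180, 181] @ map (\<lambda>p. (p, 3)) [200..<212])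
    ([0, 1, 180, 181] @ [200..<204])"
    by code_simp
qed

theorem lemma4p1:
  "GDD_exists 5 [(2, 35)] \<and>
   GDD_exists 5 [(2, 71)] \<and>
   GDD_exists 5 [(10, 23)] \<and>
   GDD_exists 5 [(2, 40), (6, 1)] \<and>
   GDD_exists 5 [(4, 40), (12, 1)] \<and>
   GDD_exists 5 [(10, 10), (18, 1)] \<and>
   GDD_exists 5 [(20, 10), (36, 1)]"
  using GDD_2_35 GDD_2_71 GDD_10_23 GDD_2_40_6_1 GDD_4_40_12_1 GDD_10_10_18_1 GDD_20_10_36_1 by blast

end
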